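(* Let $A \in \mathbb{R}^{n \times n}$, $\boldsymbol{b}, \boldsymbol{x}_0 \in \mathbb{R}^n$, $\boldsymbol{r}_0 = \boldsymbol{b} - A\boldsymbol{x}_0 \neq \boldsymbol{0}$, and let $k \geq 1$ be such that $\dim \mathcal{K}_k(A,\boldsymbol{r}_0) = k$. Then the extended Hessenberg matrix $H_{k+1,k}$ of GMRES satisfies $$\sigma_k(H_{k+1,k}) \leq \frac{\|A\boldsymbol{r}_0\|}{\|\boldsymbol{r}_0\|} \leq \frac{\|A\|\,\big\|\boldsymbol{r}_0|_{\mathcal{R}(A^{\mathsf{T}})}\big\|}{\|\boldsymbol{r}_0\|}.$$
   Context: $\|\cdot\|$ is the Euclidean vector norm and the induced matrix norm, $\sigma_k(\cdot)$ is the $k$th largest singular value, and $\boldsymbol{r}_0|_{\mathcal{R}(A^{\mathsf{T}})}$ is the orthogonal projection of $\boldsymbol{r}_0$ onto $\mathcal{R}(A^{\mathsf{T}})$, the range of $A^{\mathsf{T}}$. $\mathcal{K}_k(A,\boldsymbol{r}_0) = \mathrm{span}\{\boldsymbol{r}_0, A\boldsymbol{r}_0, \dots, A^{k-1}\boldsymbol{r}_0\}$ is the Krylov subspace. The extended Hessenberg matrix $H_{k+1,k} \in \mathbb{R}^{(k+1)\times k}$ comes from the Arnoldi decomposition $A Q_k = Q_{k+1} H_{k+1,k}$, where $Q_k = [\boldsymbol{q}_1,\dots,\boldsymbol{q}_k]$ has orthonormal columns with $\boldsymbol{q}_1 = \boldsymbol{r}_0/\|\boldsymbol{r}_0\|$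 and $\mathrm{span}\{\boldsymbol{q}_1,\dots,\boldsymbol{q}_i\} = \mathcal{K}_i(A,\boldsymbol{r}_0)$ for $i\le k$, and $Q_{k+1} = [Q_k,\boldsymbol{q}_{k+1}]$ where $\boldsymbol{q}_{k+1}$ extends this to an orthonormal basis of $\mathcal{K}_{k+1}(A,\boldsymbol{r}_0)$ if $\dim \mathcal{K}_{k+1}(A,\boldsymbol{r}_0) = k+1$; if $\dim \mathcal{K}_{k+1}(A,\boldsymbol{r}_0) = k$, the last row of $H_{k+1,k}$ is zero and $A Q_k = Q_k H_{k,k}$ with $H_{k,k}$ the first $k$ rows. In particular $\|A Q_k \boldsymbol{w}\| = \|H_{k+1,k}\boldsymbol{w}\|$ for all $\boldsymbol{w}\in\mathbb{R}^k$. *)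

theory Defs
  imports "HOL-Analysis.Analysis" "Jordan_Normal_Form.Char_Poly"
begin

text \<open>
  Matrices whose dimensions are those of the ambient space have type \<^typ>\<open>real^'n^'n\<close>.
  The extended Hessenberg matrix has a size that depends on the natural number \<open>k\<close>
  and is therefore a matrix with an explicit carrier, \<^typ>\<open>real Matrix.mat\<close>.
\<close>

text \<open>
  The singular values of an \<open>m \<times> n\<close> matrix \<open>M\<close> with \<open>m \<ge> n\<close> in decreasing order: square
  roots of the \<open>n\<close> eigenvalues of \<open>M\<^sup>T M\<close>, counted with multiplicity. These are roots of
  the real characteristic polynomial, since \<open>M\<^sup>T M\<close> is symmetric. If \<open>m < n\<close>, the list
  ends with \<open>n - m\<close> additional zeros.
\<close>

definition singular_values :: "real Matrix.mat \<Rightarrow> real list" where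
  "singular_values M =
     rev (sorted_list_of_multiset
       (image_mset sqrt (proots (char_poly (transpose_mat M * M)))))"

text \<open>The \<open>k\<close>th largest singular value, with \<open>k\<close> counted from 1.\<close>

definition singular_value :: "nat \<Rightarrow> real Matrix.mat \<Rightarrow> real" where
  "singular_value k M = singular_values M ! (k - 1)"

definition krylov :: "real^'n^'n \<Rightarrow> real^'n \<Rightarrow> nat \<Rightarrow> (real^'n) set" where
  "krylov A r k = span ((\<lambda>i. (((*v) A) ^^ i) r) ` {..<k})"

definition orth_proj :: "'a::euclidean_space set \<Rightarrow> 'a \<Rightarrow> 'a" where
  "orth_proj S x = (THE y. y \<in> S \<and> (\<forall>z\<in>S. inner (x - y) z = 0))"

definition orthonormal_family :: "nat \<Rightarrow> (nat \<Rightarrow> 'a::real_inner) \<Rightarrow> bool" where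
  "orthonormal_family m q \<longleftrightarrow>
     (\<forall>i<m. \<forall>j<m. inner (q i) (q j) = (if i = j then 1 else 0))"

text \<open>
  Arnoldi decomposition. Indices start at 0, so \<open>q i\<close> is the basis vector usually called
  \<open>q\<^bsub>i+1\<^esub>\<close>. The matrix identities \<open>A Q\<^bsub>k\<^esub> = Q\<^bsub>k+1\<^esub> H\<close> and \<open>A Q\<^bsub>k\<^esub> = Q\<^bsub>k\<^esub> H\<^bsub>k,k\<^esub>\<close> are written
  column by column. In the breakdown case the value of \<open>q k\<close> is irrelevant.
\<close>

definition arnoldi ::
  "real^'n^'n \<Rightarrow> real^'n \<Rightarrow> nat \<Rightarrow> (nat \<Rightarrow> real^'n) \<Rightarrow> real Matrix.mat \<Rightarrow> bool" where
  "arnoldi A r k q H \<longleftrightarrow>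
     H \<in> carrier_mat (k + 1) k \<and>
     orthonormal_family k q \<and>
     q 0 = (1 / norm r) *\<^sub>R r \<and>
     (\<forall>i\<le>k. span (q ` {..<i}) = krylov A r i) \<and>
     (if dim (krylov A r (k + 1)) = k + 1
      then orthonormal_family (k + 1) q \<and>
           span (q ` {..<k + 1}) = krylov A r (k + 1) \<and>
           (\<forall>j<k. A *v q j = (\<Sum>i<k + 1. H $$ (i, j) *\<^sub>R q i))
      else (\<forall>j<k. H $$ (k, j) = 0) \<and>
           (\<forall>j<k. A *v q j = (\<Sum>i<k. H $$ (i, j) *\<^sub>R q i)))"

end

theory Submission
  imports Defs
begin

text \<open>
  The matrix \<open>H\<^sup>T H\<close> is the Gram matrix of the vectors \<open>A q\<^bsub>j\<^esub>\<close>, so its smallest eigenvalue is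
  at most its first diagonal entry \<open>(norm (A r) / norm r)\<^sup>2\<close>. To obtain an eigenvalue with this
  bound, minimize \<open>norm (A v)\<close> over the unit vectors \<open>v\<close> of the Krylov space: the coordinates of
  a minimizer with respect to \<open>q\<close> form an eigenvector of \<open>H\<^sup>T H\<close>. That all roots of the
  characteristic polynomial of \<open>H\<^sup>T H\<close> are real is needed for the list of singular values to
  have length \<open>k\<close>, which makes its entry \<open>k - 1\<close> the minimum. For the second inequality,
  \<open>r\<close> and its projection onto the row space differ by an element of the kernel of \<open>A\<close>.
\<close>

section \<open>Symmetric matrices and their singular values\<close>

text \<open>Moving the real symmetric matrix from one factor of \<open>v \<bullet>c v\<close> to the
  other turns \<open>\<mu>\<close> into its conjugate; since \<open>v \<bullet>c v\<close> is
  nonzero, the two agree.\<close>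

lemma real_symmetric_complex_eigenvalue:
  fixes G :: "real mat"
  assumes G: "G \<in> carrier_mat n n" and sym: "transpose_mat G = G"
    and ev: "eigenvalue (map_mat complex_of_real G) \<mu>"
  shows "\<mu> \<in> \<real>"
proof -
  let ?C = "map_mat complex_of_real G"
  have C: "?C \<in> carrier_mat n n" using G by simp
  have C_sym: "transpose_mat ?C = ?C"
    using sym by (metis map_mat_transpose)
  from ev obtain v where v: "v \<in> carrier_vec n" "v \<noteq> 0\<^sub>v n" and Cv: "?C *\<^sub>v v = \<mu> \<cdot>\<^sub>v v"
    using C unfolding eigenvalue_def eigenvector_def by auto
  have cv: "conjugate v \<in> carrier_vec n" using v(1) by simp
  have conj_Cv: "?C *\<^sub>v conjugate v = conjugate \<mu> \<cdot>\<^sub>v conjugate v"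
  proof -
    have "?C *\<^sub>v conjugate v = conjugate (?C *\<^sub>v v)"
      using G v(1) by (intro eq_vecI) (auto simp: scalar_prod_def)
    then show ?thesis by (simp add: Cv conjugate_smult_vec)
  qed
  have "\<mu> * (v \<bullet>c v) = (transpose_mat ?C *\<^sub>v v) \<bullet>c v"
    using v(1) cv by (simp add: C_sym Cv)
  also have "\<dots> = scalar_prod v (?C *\<^sub>v conjugate v)"
    by (rule transpose_vec_mult_scalar[OF C cv v(1)])
  also have "\<dots> = conjugate \<mu> * (v \<bullet>c v)"
    using v(1) cv by (simp add: conj_Cv)
  finally have "\<mu> = conjugate \<mu>"
    using v conjugate_square_eq_0_vec[OF v(1)] by simp
  then show ?thesis by (simp add: Reals_cnj_iff)
qed

text \<open>The polynomial splits over the complex numbers with real roots only; the factorization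
  descends because the coefficient embedding is injective on polynomials.\<close>

lemma real_symmetric_char_poly_splits:
  fixes G :: "real mat"
  assumes G: "G \<in> carrier_mat n n" and sym: "transpose_mat G = G"
  obtains rs where "char_poly G = (\<Prod>r\<leftarrow>rs. [:- r, 1:])" and "length rs = n"
proof -
  let ?C = "map_mat complex_of_real G"
  interpret p: map_poly_inj_idom_hom complex_of_real ..
  have C: "?C \<in> carrier_mat n n" using G by simp
  obtain as where as: "char_poly ?C = (\<Prod>a\<leftarrow>as. [:- a, 1:])" "length as = n"
    using char_poly_factorized[OF C] by blast
  have "\<forall>a\<in>set as. a \<in> \<real>"
  proof
    fix a assume "a \<in> set as"
    then have "poly (char_poly ?C) a = 0"
      unfolding as(1) by (rule linear_poly_root)
    then show "a \<in> \<real>"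
      using real_symmetric_complex_eigenvalue[OF G sym] eigenvalue_root_char_poly[OF C] by blast
  qed
  then have "map complex_of_real (map Re as) = as"
    by (auto intro!: map_idI)
  then have "map_poly complex_of_real (char_poly G)
      = (\<Prod>a\<leftarrow>map complex_of_real (map Re as). [:- a, 1:])"
    using as(1) by (simp add: of_real_hom.char_poly_hom[OF G])
  also have "\<dots> = map_poly complex_of_real (\<Prod>r\<leftarrow>map Re as. [:- r, 1:])"
    by (simp add: p.hom_prod_list o_def)
  finally have "char_poly G = (\<Prod>r\<leftarrow>map Re as. [:- r, 1:])"
    by (rule p.injectivity)
  then show thesis using that as(2) by (metis length_map)
qed

lemma size_proots_char_poly_symmetric:
  fixes G :: "real mat"
  assumes "G \<in> carrier_mat n n" and "transpose_mat G = G"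
  shows "size (proots (char_poly G)) = n"
proof -
  obtain rs where rs: "char_poly G = (\<Prod>r\<leftarrow>rs. [:- r, 1:])" "length rs = n"
    using real_symmetric_char_poly_splits[OF assms] .
  have "proots (\<Prod>r\<leftarrow>rs. [:- r, 1:]) = mset rs"
  proof (induction rs)
    case (Cons r rs)
    have "(\<Prod>r\<leftarrow>rs. [:- r, 1:]) \<noteq> 0"
      by (auto simp: prod_list_zero_iff)
    then have "proots ([:- r, 1:] * (\<Prod>r\<leftarrow>rs. [:- r, 1:]))
        = proots [:- r, 1:] + proots (\<Prod>r\<leftarrow>rs. [:- r, 1:])"
      by (intro proots_mult) auto
    then show ?case by (simp only: Cons.IH list.map prod_list.Cons proots_linear_factor) simp
  qed simp
  then show ?thesis using rs by (metis size_mset)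
qed

text \<open>The ascending list has exactly \<open>k\<close> entries, so reversal moves its minimum
  to index \<open>k - 1\<close>, and \<open>sqrt m\<close> is one of the entries.\<close>

lemma last_singular_value_le:
  assumes M: "M \<in> carrier_mat n k" and "k \<ge> 1"
    and ev: "eigenvalue (transpose_mat M * M) m"
  shows "singular_value k M \<le> sqrt m"
proof -
  let ?G = "transpose_mat M * M"
  let ?S = "image_mset sqrt (proots (char_poly ?G))"
  let ?xs = "sorted_list_of_multiset ?S"
  have G: "?G \<in> carrier_mat k k" using M by simp
  have G_sym: "transpose_mat ?G = ?G"
    using M by (simp add: transpose_mult[of _ k n _ k])
  have "length ?xs = size ?S"
    by (metis mset_sorted_list_of_multiset size_mset)
  then have len: "length ?xs = k"
    by (simp add: size_proots_char_poly_symmetric[OF G G_sym])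
  \<comment> \<open>\<open>proots 0\<close> is empty by convention, so passing from a root to a
    member of \<open>proots\<close> requires a nonzero polynomial.\<close>
  have "char_poly ?G \<noteq> 0"
    using degree_monic_char_poly[OF G] by auto
  then have "sqrt m \<in># ?S"
    using ev eigenvalue_root_char_poly[OF G] by auto
  then have "sqrt m \<in> set ?xs" by simp
  moreover have "sorted ?xs" by simp
  ultimately have "?xs ! 0 \<le> sqrt m"
    by (metis in_set_conv_nth le0 sorted_nth_mono)
  moreover have "singular_value k M = ?xs ! 0"
    using len \<open>k \<ge> 1\<close> unfolding singular_value_def singular_values_def
    by (simp add: rev_nth)
  ultimately show ?thesis by simp
qed

section \<open>Minimizers of the Rayleigh quotient\<close>

text \<open>A minimizer exists because the unit sphere of \<open>S\<close> is compact. The last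
  property is the stationarity condition at \<open>v\<close> in directions of \<open>S\<close>,
  obtained from a nonnegative quadratic form instead of derivatives.\<close>

lemma rayleigh_minimizer:
  fixes f :: "'a::euclidean_space \<Rightarrow> 'b::euclidean_space"
  assumes f: "linear f" and S: "subspace S" and x: "x \<in> S" "norm x = 1"
  obtains v m where "v \<in> S" and "norm v = 1" and "m \<le> (norm (f x))\<^sup>2"
    and "\<And>u. u \<in> S \<Longrightarrow> inner (f v) (f u) = m * inner v u"
proof -
  have "compact (S \<inter> sphere 0 1)"
    using closed_subspace[OF S] by (simp add: closed_Int_compact)
  moreover have "x \<in> S \<inter> sphere 0 1" using x by simp
  moreover have "continuous_on (S \<inter> sphere 0 1) (\<lambda>y. (norm (f y))\<^sup>2)"
    using f by (intro continuous_intros linear_continuous_on) (simp add: linear_conv_bounded_linear)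
  ultimately obtain v where v: "v \<in> S" "norm v = 1"
    and min: "\<And>y. y \<in> S \<Longrightarrow> norm y = 1 \<Longrightarrow> (norm (f v))\<^sup>2 \<le> (norm (f y))\<^sup>2"
    using continuous_attains_inf[of "S \<inter> sphere 0 1" "\<lambda>y. (norm (f y))\<^sup>2"] by fastforce
  define m where "m = (norm (f v))\<^sup>2"
  \<comment> \<open>By homogeneity, minimality of \<open>m\<close> on unit vectors becomes
    nonnegativity of the quadratic form \<open>g\<close> on all of \<open>S\<close>, with value 0 at
    \<open>v\<close>.\<close>
  define g where "g y = (norm (f y))\<^sup>2 - m * (norm y)\<^sup>2" for y
  have g_nonneg: "g y \<ge> 0" if "y \<in> S" for y
  proof (cases "y = 0")
    case True
    then show ?thesis by (simp add: g_def linear_0[OF f])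
  next
    case False
    have "m \<le> (norm (f ((1 / norm y) *\<^sub>R y)))\<^sup>2"
      unfolding m_def using False that S by (intro min) (auto simp: subspace_scale)
    also have "\<dots> = (norm (f y))\<^sup>2 / (norm y)\<^sup>2"
      by (simp add: linear_scale[OF f] power_divide)
    finally show ?thesis
      using False by (simp add: g_def field_simps)
  qed
  have "inner (f v) (f u) = m * inner v u" if u: "u \<in> S" for u
  proof -
    define B where "B = inner (f v) (f u) - m * inner v u"
    \<comment> \<open>\<open>g (v + t u) = 2 t B + t\<^sup>2 g u\<close> is nonnegative for all \<open>t\<close>; this \<open>t\<close> forces \<open>B = 0\<close>\<close>
    define t where "t = - B / (g u + 1)"
    have C: "g u \<ge> 0" using u by (rule g_nonneg)
    have "g (v + t *\<^sub>R u) \<ge> 0"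
      using u v(1) S by (intro g_nonneg) (simp add: subspace_add subspace_scale)
    also have "g (v + t *\<^sub>R u) = g v + 2 * t * B + t\<^sup>2 * g u"
      unfolding g_def B_def power2_norm_eq_inner
      by (simp add: linear_add[OF f] linear_scale[OF f] inner_add_left inner_add_right
          inner_commute[of u v] inner_commute[of "f u" "f v"] algebra_simps power2_eq_square)
    also have "g v = 0" by (simp add: g_def m_def v(2))
    \<comment> \<open>The square clears the denominator of \<open>t\<close>; the summand 1 in it
      keeps it positive even if \<open>g u = 0\<close>.\<close>
    finally have "0 \<le> (2 * t * B + t\<^sup>2 * g u) * (g u + 1)\<^sup>2" by simp
    also have "\<dots> = 2 * (t * (g u + 1)) * B * (g u + 1) + (t * (g u + 1))\<^sup>2 * g u"
      by (simp add: algebra_simps power2_eq_square)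
    also have "t * (g u + 1) = - B" using C by (simp add: t_def)
    also have "2 * (- B) * B * (g u + 1) + (- B)\<^sup>2 * g u = - B\<^sup>2 * (g u + 2)"
      by (simp add: algebra_simps power2_eq_square)
    finally have "B\<^sup>2 * (g u + 2) \<le> 0" by simp
    then have "B = 0"
      using C by (simp add: mult_le_0_iff)
    then show ?thesis by (simp add: B_def)
  qed
  moreover have "m \<le> (norm (f x))\<^sup>2" unfolding m_def using x by (intro min)
  ultimately show thesis using that v by blast
qed

section \<open>The Arnoldi decomposition\<close>

lemma orthonormal_family_inner_sum:
  assumes "orthonormal_family n q"
  shows "inner (\<Sum>i<n. a i *\<^sub>R q i) (\<Sum>i<n. b i *\<^sub>R q i) = (\<Sum>i<n. a i * b i)"
proof -
  have "inner (\<Sum>i<n. a i *\<^sub>R q i) (\<Sum>j<n. b j *\<^sub>R q j)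
      = (\<Sum>i<n. \<Sum>j<n. a i * (b j * inner (q i) (q j)))"
    by (simp only: inner_sum_left) (simp add: inner_sum_right sum_distrib_left mult.left_commute)
  also have "\<dots> = (\<Sum>i<n. \<Sum>j<n. if i = j then a i * b j else 0)"
    using assms unfolding orthonormal_family_def by (intro sum.cong refl) auto
  finally show ?thesis by simp
qed

lemma orthonormal_family_expansion:
  assumes q: "orthonormal_family n q" and "v \<in> span (q ` {..<n})"
  shows "v = (\<Sum>i<n. inner v (q i) *\<^sub>R q i)"
  using assms(2)
proof (induction rule: span_induct)
  case base
  \<comment> \<open>The vectors that equal their expansion form the kernel of this map, hence a
    subspace.\<close>
  have "linear (\<lambda>v. v - (\<Sum>i<n. inner v (q i) *\<^sub>R q i))"
    by (intro linearI) (simp_all add: inner_add_left scaleR_add_left sum.distrib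
        scaleR_sum_right scaleR_diff_right)
  from linear_subspace_kernel[OF this] show ?case by simp
next
  case (step x)
  then obtain j where j: "j < n" "x = q j" by auto
  have "(\<Sum>i<n. inner (q j) (q i) *\<^sub>R q i) = (\<Sum>i<n. if j = i then q i else 0)"
    using q j(1) unfolding orthonormal_family_def by (intro sum.cong refl) auto
  then show ?case using j by simp
qed

text \<open>Column \<open>j\<close> of \<open>H\<close> holds the coordinates of
  \<open>A *v q j\<close> in an orthonormal family, and such coordinates preserve inner products. On
  breakdown the last row of \<open>H\<close> is zero, so the summand for \<open>i = k\<close>
  vanishes.\<close>

lemma arnoldi_gram:
  assumes arn: "arnoldi A r k q H" and "j < k" "l < k"
  shows "(transpose_mat H * H) $$ (j, l) = inner (A *v q j) (A *v q l)"
proof -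
  have H: "H \<in> carrier_mat (k + 1) k" using arn by (simp add: arnoldi_def)
  then have "(transpose_mat H * H) $$ (j, l) = (\<Sum>i<k + 1. H $$ (i, j) * H $$ (i, l))"
    using assms by (auto simp: scalar_prod_def atLeast0LessThan intro!: sum.cong)
  also have "\<dots> = inner (A *v q j) (A *v q l)"
  proof (cases "dim (krylov A r (k + 1)) = k + 1")
    case True
    then have "orthonormal_family (k + 1) q"
      and "\<forall>j<k. A *v q j = (\<Sum>i<k + 1. H $$ (i, j) *\<^sub>R q i)"
      using arn by (simp_all add: arnoldi_def)
    then have "A *v q j = (\<Sum>i<k + 1. H $$ (i, j) *\<^sub>R q i)" "A *v q l = (\<Sum>i<k + 1. H $$ (i, l) *\<^sub>R q i)"
      using assms(2,3) by blast+
    then show ?thesis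
      by (simp only: orthonormal_family_inner_sum[OF \<open>orthonormal_family (k + 1) q\<close>])
  next
    case False
    then have "orthonormal_family k q" "\<forall>j<k. H $$ (k, j) = 0"
      and "\<forall>j<k. A *v q j = (\<Sum>i<k. H $$ (i, j) *\<^sub>R q i)"
      using arn by (simp_all add: arnoldi_def)
    then show ?thesis
      using assms orthonormal_family_inner_sum[of k q] by simp
  qed
  finally show ?thesis .
qed

lemma arnoldi_singular_value_le:
  assumes arn: "arnoldi A r k q H" and k: "k \<ge> 1"
  shows "singular_value k H \<le> norm (A *v q 0)"
proof -
  let ?G = "transpose_mat H * H"
  have H: "H \<in> carrier_mat (k + 1) k" and q: "orthonormal_family k q"
    using arn by (simp_all add: arnoldi_def)
  have G: "?G \<in> carrier_mat k k" using H by simp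
  \<comment> \<open>\<open>q 0\<close> serves as the unit vector with which the minimizer is
    compared; this bounds \<open>m\<close>.\<close>
  have "q 0 \<in> span (q ` {..<k})" using k by (intro span_base) auto
  moreover have "norm (q 0) = 1"
    using q k unfolding orthonormal_family_def norm_eq_1 by simp
  ultimately obtain v m where v: "v \<in> span (q ` {..<k})" "norm v = 1"
    and m: "m \<le> (norm (A *v q 0))\<^sup>2"
    and crit: "\<And>u. u \<in> span (q ` {..<k}) \<Longrightarrow> inner (A *v v) (A *v u) = m * inner v u"
    using rayleigh_minimizer[OF matrix_vector_mul_linear subspace_span] by metis
  define c where "c i = inner v (q i)" for i
  have v_eq: "v = (\<Sum>i<k. c i *\<^sub>R q i)"
    unfolding c_def using orthonormal_family_expansion[OF q v(1)] .
  let ?w = "Matrix.vec k c"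
  have "eigenvector ?G ?w m"
    unfolding eigenvector_def
  proof (intro conjI)
    show "?w \<in> carrier_vec (dim_row ?G)" using H by simp
    show "?w \<noteq> 0\<^sub>v (dim_row ?G)"
    proof
      assume "?w = 0\<^sub>v (dim_row ?G)"
      then have "\<forall>i<k. c i = 0"
        using H by (metis carrier_matD(2) index_mult_mat(2) index_transpose_mat(2) index_vec index_zero_vec(1))
      then have "v = 0" by (subst v_eq) simp
      then show False using v(2) by simp
    qed
    show "?G *\<^sub>v ?w = m \<cdot>\<^sub>v ?w"
    proof (rule eq_vecI)
      fix j assume "j < dim_vec (m \<cdot>\<^sub>v ?w)"
      then have j: "j < k" by simp
      have "vec_index (?G *\<^sub>v ?w) j = (\<Sum>l<k. ?G $$ (j, l) * c l)"
        using G j by (auto simp: scalar_prod_def atLeast0LessThan simp del: index_mult_mat intro!: sum.cong)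
      also have "\<dots> = (\<Sum>l<k. inner (A *v q j) (A *v q l) * c l)"
        using arnoldi_gram[OF arn j] by simp
      also have "\<dots> = inner (A *v q j) (A *v v)"
        by (subst v_eq) (simp add: linear_sum[OF matrix_vector_mul_linear] inner_sum_right
            matrix_vector_mult_scaleR mult.commute)
      \<comment> \<open>Stationarity tested against \<open>u = q j\<close> is row \<open>j\<close>
        of the eigenvector equation.\<close>
      also have "\<dots> = m * c j"
        using crit[of "q j"] j by (simp add: span_base c_def inner_commute)
      finally show "vec_index (?G *\<^sub>v ?w) j = vec_index (m \<cdot>\<^sub>v ?w) j"
        using j by simp
    qed (use H in simp)
  qed
  then have "singular_value k H \<le> sqrt m"
    by (intro last_singular_value_le[OF H k]) (auto simp: eigenvalue_def)
  also have "\<dots> \<le> norm (A *v q 0)"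
    using m by (simp add: real_le_lsqrt)
  finally show ?thesis .
qed

section \<open>The projection onto the row space\<close>

text \<open>The definite description needs existence, from the orthogonal decomposition, and
  uniqueness: the difference of two candidates lies in \<open>S\<close> and is orthogonal to
  itself.\<close>

lemma orth_proj_characterization:
  fixes x :: "'a::euclidean_space"
  assumes S: "subspace S"
  shows "orth_proj S x \<in> S" and "z \<in> S \<Longrightarrow> inner (x - orth_proj S x) z = 0"
proof -
  obtain y z where yz: "y \<in> span S" "\<And>w. w \<in> span S \<Longrightarrow> Linear_Algebra.orthogonal z w" "x = y + z"
    using orthogonal_subspace_decomp_exists[of S x] by blast
  have span: "span S = S" using S by (simp add: span_eq_iff)
  let ?P = "\<lambda>y. y \<in> S \<and> (\<forall>z\<in>S. inner (x - y) z = 0)"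
  have P: "?P y" using yz by (simp add: span Linear_Algebra.orthogonal_def)
  have "y' = y" if "?P y'" for y'
  proof -
    have "y' - y \<in> S" using P that S by (simp add: subspace_diff)
    then have "inner (x - y) (y' - y) = 0" "inner (x - y') (y' - y) = 0"
      using P that by blast+
    then have "inner (y' - y) (y' - y) = 0" by (simp add: inner_diff_left)
    then show ?thesis by simp
  qed
  with P have *: "?P (orth_proj S x)"
    unfolding orth_proj_def by (rule theI)
  show "orth_proj S x \<in> S" using * by blast
  show "z \<in> S \<Longrightarrow> inner (x - orth_proj S x) z = 0" for z using * by blast
qed

text \<open>The residual \<open>?d\<close> is orthogonal to the row space, in particular to
  \<open>transpose A *v (A *v ?d)\<close>; moving the transpose across gives \<open>A *v ?d\<close>
  squared norm 0.\<close>

lemma matrix_vector_orth_proj_row_space: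
  fixes A :: "real^'n^'m"
  shows "A *v orth_proj (range ((*v) (transpose A))) x = A *v x"
proof -
  let ?d = "x - orth_proj (range ((*v) (transpose A))) x"
  have "subspace (range ((*v) (transpose A)))"
    by (intro linear_subspace_image matrix_vector_mul_linear subspace_UNIV)
  then have "inner ?d (transpose A *v (A *v ?d)) = 0"
    by (rule orth_proj_characterization(2)) simp
  also have "inner ?d (transpose A *v (A *v ?d)) = inner (A *v ?d) (A *v ?d)"
    by (metis dot_lmul_matrix inner_commute transpose_matrix_vector)
  finally show ?thesis by (simp add: matrix_vector_mult_diff_distrib)
qed

theorem mainTheorem4:
  fixes A :: "real^'n^'n" and b x0 r0 :: "real^'n" and k :: nat
    and q :: "nat \<Rightarrow> real^'n" and H :: "real Matrix.mat"
  assumes "r0 = b - A *v x0"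
    and "r0 \<noteq> 0"
    and "k \<ge> 1"
    and "dim (krylov A r0 k) = k"
    and "arnoldi A r0 k q H"
  shows "singular_value k H \<le> norm (A *v r0) / norm r0 \<and>
         norm (A *v r0) / norm r0
           \<le> onorm ((*v) A) * norm (orth_proj (range ((*v) (transpose A))) r0) / norm r0"
proof
  have "q 0 = (1 / norm r0) *\<^sub>R r0" using assms(5) by (simp add: arnoldi_def)
  then have "norm (A *v q 0) = norm (A *v r0) / norm r0"
    by (simp add: matrix_vector_mult_scaleR)
  then show "singular_value k H \<le> norm (A *v r0) / norm r0"
    using arnoldi_singular_value_le[OF assms(5,3)] by simp
  \<comment> \<open>Replacing \<open>r0\<close> by its projection leaves the image under
    \<open>A\<close> unchanged, so the operator norm bound applies to the projection.\<close>
  have "norm (A *v r0) \<le> onorm ((*v) A) * norm (orth_proj (range ((*v) (transpose A))) r0)"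
    using onorm[OF matrix_vector_mul_bounded_linear] matrix_vector_orth_proj_row_space by metis
  then show "norm (A *v r0) / norm r0
      \<le> onorm ((*v) A) * norm (orth_proj (range ((*v) (transpose A))) r0) / norm r0"
    by (simp add: divide_right_mono)
qed

end
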